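(* Let $L$ be a finite loop, let $\psi\in\mathcal{Z}^2_{\mathcal{L}}(L)$ and let $f\in\mathcal{C}^1(L)$ be such that $\delta_\psi=\delta^2(f)$. Let $\phi_{\psi,f}\in\mathcal{C}^2(L)$ be defined by $\phi_{\psi,f}(a,b):=\psi(a,b)+f(ab)$ for all $a,b\in L$. Then the matrix $M_{\phi_{\psi,f}}$ is Hadamard equivalent to the cocyclic matrix $M_{\psi+\delta_f}$. As a consequence, $M_{\phi_{\psi,f}}$ is Hadamard if and only if $M_{\psi+\delta_f}$ is Hadamard.
   Context: A loop is a set $L$ with a binary operation (written by juxtaposition, not necessarily associative) having an identity element $e$ and such that for all $a,b\in L$ the equations $ax=b$ and $ya=b$ have unique solutions $x,y\in L$. $\mathcal{C}^k(L)$ is the set of all functions $L^k\to\mathbb{Z}_2$, with pointwise addition. For $f\in\mathcal{C}^1(L)$, $\delta_f\in\mathcal{C}^2(L)$ is $\delta_f(a,b):=f(a)+f(b)+f(ab)$; for $\psi\in\mathcal{C}^2(L)$, $\delta_\psi\in\mathcal{C}^3(L)$ is $\delta_\psi(a,b,c):=\psi(a,b)+\psi(b,c)+\psi(ab,c)+\psi(a,bc)$; and $\delta^2(f):=\delta_{\delta_f}$. A $2$-cocycle is $\psi\in\mathcal{C}^2(L)$ with $\delta_\psi=\mathbf{0}$; the matrix $M_\psi$ is called cocyclic over $L$ when $\psi$ is a $2$-cocycle. $\mathcal{Z}^2_{\mathcal{L}}(L)$ is the set of $2$-loop-cocycles: those $\psi\in\mathcal{C}^2(L)$ such that $\delta_\psi=\delta^2(f)$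 for some $f\in\mathcal{C}^1(L)$. For $\psi\in\mathcal{C}^2(L)$, $M_\psi$ is the matrix indexed by $L$ with $M_\psi[a,b]:=(-1)^{\psi(a,b)}$. A $\pm1$ matrix $M$ of order $n$ is Hadamard if $MM^T=nI_n$. Two $\pm 1$ matrices are Hadamard equivalent if one is obtained from the other by permutations and negations of rows and columns. *)

theory Defs
  imports "HOL-Analysis.Cartesian_Space" "HOL-Library.Z2" "HOL-Library.Function_Algebras"
begin

class loop = times + one +
  assumes loop_one_left: "1 * a = a"
    and loop_one_right: "a * 1 = a"
    and loop_left_division: "\<exists>!x. a * x = b"
    and loop_right_division: "\<exists>!y. y * a = b"

text \<open>
  For a loop given by a type \<open>'a\<close>, the \<open>k\<close>-cochains with values in \<open>\<int>\<^sub>2\<close> are the curried functions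
  \<open>'a \<Rightarrow> \<dots> \<Rightarrow> 'a \<Rightarrow> bit\<close>; \<open>+\<close> and \<open>0\<close> on cochains are the pointwise operations of
  \<^theory>\<open>HOL-Library.Function_Algebras\<close>.
\<close>

definition delta1 :: "('a::loop \<Rightarrow> bit) \<Rightarrow> 'a \<Rightarrow> 'a \<Rightarrow> bit" where
  "delta1 f = (\<lambda>a b. f a + f b + f (a * b))"

definition delta2 :: "('a::loop \<Rightarrow> 'a \<Rightarrow> bit) \<Rightarrow> 'a \<Rightarrow> 'a \<Rightarrow> 'a \<Rightarrow> bit" where
  "delta2 \<psi> = (\<lambda>a b c. \<psi> a b + \<psi> b c + \<psi> (a * b) c + \<psi> a (b * c))"

definition delta_sq :: "('a::loop \<Rightarrow> bit) \<Rightarrow> 'a \<Rightarrow> 'a \<Rightarrow> 'a \<Rightarrow> bit" where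
  "delta_sq f = delta2 (delta1 f)"

definition two_cocycle :: "('a::loop \<Rightarrow> 'a \<Rightarrow> bit) \<Rightarrow> bool" where
  "two_cocycle \<psi> \<longleftrightarrow> delta2 \<psi> = 0"

definition two_loop_cocycles :: "('a::loop \<Rightarrow> 'a \<Rightarrow> bit) set" where
  "two_loop_cocycles = {\<psi>. \<exists>f. delta2 \<psi> = delta_sq f}"

definition cochain_matrix :: "('a::finite \<Rightarrow> 'a \<Rightarrow> bit) \<Rightarrow> int ^ 'a ^ 'a" where
  "cochain_matrix \<psi> = (\<chi> a b. (- 1) ^ of_bit (\<psi> a b))"

definition cocyclic :: "((int, 'a::{finite,loop}) vec, 'a) vec \<Rightarrow> bool" where
  "cocyclic M \<longleftrightarrow> (\<exists>\<psi>. two_cocycle \<psi> \<and> M = cochain_matrix \<psi>)"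

definition phi :: "('a::loop \<Rightarrow> 'a \<Rightarrow> bit) \<Rightarrow> ('a \<Rightarrow> bit) \<Rightarrow> 'a \<Rightarrow> 'a \<Rightarrow> bit" where
  "phi \<psi> f = (\<lambda>a b. \<psi> a b + f (a * b))"

definition pm1_matrix :: "int ^ 'n ^ 'm \<Rightarrow> bool" where
  "pm1_matrix M \<longleftrightarrow> (\<forall>i j. M $ i $ j \<in> {1, - 1})"

text \<open>Here \<open>mat k\<close> is \<open>k\<close> times the identity matrix.\<close>

definition hadamard :: "int ^ 'n ^ 'n \<Rightarrow> bool" where
  "hadamard M \<longleftrightarrow> pm1_matrix M \<and> M ** transpose M = mat (int CARD('n))"

inductive hadamard_equivalent :: "int ^ 'n ^ 'm \<Rightarrow> int ^ 'n ^ 'm \<Rightarrow> bool"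
  for M :: "int ^ 'n ^ 'm"
where
  refl: "pm1_matrix M \<Longrightarrow> hadamard_equivalent M M"
| permute_rows: "hadamard_equivalent M N \<Longrightarrow> bij p \<Longrightarrow>
    hadamard_equivalent M (\<chi> i j. N $ p i $ j)"
| permute_columns: "hadamard_equivalent M N \<Longrightarrow> bij p \<Longrightarrow>
    hadamard_equivalent M (\<chi> i j. N $ i $ p j)"
| negate_row: "hadamard_equivalent M N \<Longrightarrow>
    hadamard_equivalent M (\<chi> i j. if i = r then - N $ i $ j else N $ i $ j)"
| negate_column: "hadamard_equivalent M N \<Longrightarrow>
    hadamard_equivalent M (\<chi> i j. if j = c then - N $ i $ j else N $ i $ j)"

end

theory Submission imports Defs begin

text \<open>
  In characteristic two, \<open>(\<psi> + \<delta>\<^sub>f)(a, b) = \<phi>(a, b) + f(a) + f(b)\<close>, where \<open>\<phi> = \<phi>\<^bsub>\<psi>,f\<^esub>\<close>. Hence the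
  matrix of \<open>\<psi> + \<delta>\<^sub>f\<close> arises from that of \<open>\<phi>\<close> by negating the rows and the columns indexed by the
  support of \<open>f\<close>.
\<close>

lemma delta2_add: "delta2 (\<psi> + \<psi>') = delta2 \<psi> + delta2 \<psi>'"
  by (simp only: delta2_def fun_eq_iff plus_fun_apply ac_simps simp_thms)

text \<open>By additivity of \<open>delta2\<close>, the coboundary here is
  \<open>delta_sq f + delta_sq f\<close>, which vanishes in characteristic two.\<close>

lemma two_cocycle_add_delta1:
  assumes "delta2 \<psi> = delta_sq f"
  shows "two_cocycle (\<psi> + delta1 f)"
  using assms by (simp add: two_cocycle_def delta2_add delta_sq_def fun_eq_iff)

text \<open>The inductive relation negates a single row at a time, so induction on the finite set is
  used; a newly inserted \<open>r\<close> lies outside \<open>R\<close>, hence its row is negated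
  exactly once.\<close>

lemma hadamard_equivalent_negate_rows:
  fixes N :: "int ^ 'n ^ 'm"
  assumes "hadamard_equivalent M N" and "finite R"
  shows "hadamard_equivalent M (\<chi> i j. if i \<in> R then - N $ i $ j else N $ i $ j)"
  using assms(2)
proof induction
  case empty
  then show ?case using assms(1) by simp
next
  case (insert r R)
  from negate_row[OF insert.IH, of r] show ?case
    by (rule back_subst) (use insert.hyps in \<open>auto simp: vec_eq_iff\<close>)
qed

lemma hadamard_equivalent_negate_columns:
  fixes N :: "int ^ 'n ^ 'm"
  assumes "hadamard_equivalent M N" and "finite C"
  shows "hadamard_equivalent M (\<chi> i j. if j \<in> C then - N $ i $ j else N $ i $ j)"
  using assms(2)
proof induction
  case empty
  then show ?case using assms(1) by simp
next
  case (insert c C)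
  from negate_column[OF insert.IH, of c] show ?case
    by (rule back_subst) (use insert.hyps in \<open>auto simp: vec_eq_iff\<close>)
qed

text \<open>Entrywise, \<open>M ** transpose M\<close> consists of the inner products of rows; in
  this form each elementary operation can be checked on a single sum.\<close>

lemma hadamard_iff:
  fixes M :: "int ^ 'n ^ 'n"
  shows "hadamard M \<longleftrightarrow> (\<forall>i j. M $ i $ j \<in> {1, - 1}) \<and>
    (\<forall>i k. (\<Sum>j\<in>UNIV. M $ i $ j * M $ k $ j) = (if i = k then int CARD('n) else 0))"
  by (simp add: hadamard_def pm1_matrix_def matrix_matrix_mult_def transpose_def mat_def vec_eq_iff)

lemma hadamard_permute_rows:
  fixes N :: "int ^ 'n ^ 'n"
  assumes "bij p"
  shows "hadamard (\<chi> i j. N $ p i $ j) \<longleftrightarrow> hadamard N"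
proof -
  have all: "(\<forall>i. P (p i)) \<longleftrightarrow> (\<forall>i. P i)" for P
    using assms by (metis bij_pointE)
  have eq: "p i = p k \<longleftrightarrow> i = k" for i k
    using assms by (simp add: bij_is_inj inj_eq)
  show ?thesis
    unfolding hadamard_iff
    \<comment> \<open>The first instance handles the entries. The second removes \<open>p\<close>
      from the first row index while the other is still \<open>p k\<close>; the third then removes
      it from the second row index.\<close>
    using all[of "\<lambda>i. \<forall>j. N $ i $ j \<in> {1, - 1}"]
      all[of "\<lambda>i. \<forall>k. (\<Sum>j\<in>UNIV. N $ i $ j * N $ p k $ j) = (if i = p k then int CARD('n) else 0)"]
      all[of "\<lambda>k. (\<Sum>j\<in>UNIV. N $ i $ j * N $ k $ j) = (if i = k then int CARD('n) else 0)" for i]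
    by (simp add: eq)
qed

lemma hadamard_permute_columns:
  fixes N :: "int ^ 'n ^ 'n"
  assumes "bij p"
  shows "hadamard (\<chi> i j. N $ i $ p j) \<longleftrightarrow> hadamard N"
proof -
  \<comment> \<open>Permuting columns only reindexes the summation in each inner product.\<close>
  have "(\<Sum>j\<in>UNIV. N $ i $ p j * N $ k $ p j) = (\<Sum>j\<in>UNIV. N $ i $ j * N $ k $ j)" for i k
    by (rule sum.reindex_bij_betw[OF assms])
  moreover have "(\<forall>j. P (p j)) \<longleftrightarrow> (\<forall>j. P j)" for P
    using assms by (metis bij_pointE)
  from this[of "\<lambda>j. N $ i $ j \<in> {1, - 1}" for i]
  have "(\<forall>j. N $ i $ p j \<in> {1, - 1}) \<longleftrightarrow> (\<forall>j. N $ i $ j \<in> {1, - 1})" for i .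
  ultimately show ?thesis
    unfolding hadamard_iff by simp
qed

lemma hadamard_negate_row:
  fixes N :: "int ^ 'n ^ 'n"
  shows "hadamard (\<chi> i j. if i = r then - N $ i $ j else N $ i $ j) \<longleftrightarrow> hadamard N"
proof -
  \<comment> \<open>The inner product changes sign when exactly one of \<open>i\<close>,
    \<open>k\<close> is \<open>r\<close>, but then its prescribed value is 0; so the conditions are
    equivalent although the sums may differ.\<close>
  have "(\<Sum>j\<in>UNIV. (if i = r then - N $ i $ j else N $ i $ j) *
        (if k = r then - N $ k $ j else N $ k $ j)) = (if i = k then int CARD('n) else 0) \<longleftrightarrow>
      (\<Sum>j\<in>UNIV. N $ i $ j * N $ k $ j) = (if i = k then int CARD('n) else 0)" for i k
    by (cases "i = r"; cases "k = r") (simp_all add: sum_negf)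
  moreover have "(if i = r then - N $ i $ j else N $ i $ j) \<in> {1, - 1} \<longleftrightarrow> N $ i $ j \<in> {1, - 1}" for i j
    by auto
  ultimately show ?thesis
    unfolding hadamard_iff vec_lambda_beta by presburger
qed

lemma hadamard_negate_column:
  fixes N :: "int ^ 'n ^ 'n"
  shows "hadamard (\<chi> i j. if j = c then - N $ i $ j else N $ i $ j) \<longleftrightarrow> hadamard N"
proof -
  \<comment> \<open>Both factors carry the same sign, so every summand is unchanged.\<close>
  have "(if j = c then - N $ i $ j else N $ i $ j) * (if j = c then - N $ k $ j else N $ k $ j)
      = N $ i $ j * N $ k $ j" for i j k
    by simp
  moreover have "(if j = c then - N $ i $ j else N $ i $ j) \<in> {1, - 1} \<longleftrightarrow> N $ i $ j \<in> {1, - 1}" for i j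
    by auto
  ultimately show ?thesis
    unfolding hadamard_iff vec_lambda_beta by presburger
qed

lemma hadamard_equivalent_imp_hadamard_iff:
  "hadamard_equivalent M N \<Longrightarrow> hadamard M \<longleftrightarrow> hadamard N"
  by (induction rule: hadamard_equivalent.induct)
    (simp_all only: hadamard_permute_rows hadamard_permute_columns
      hadamard_negate_row hadamard_negate_column)

lemma pm1_matrix_cochain_matrix: "pm1_matrix (cochain_matrix \<psi>)"
  by (simp add: pm1_matrix_def cochain_matrix_def minus_one_power_iff)

lemma hadamard_equivalent_phi:
  fixes \<psi> :: "'a::{finite,loop} \<Rightarrow> 'a \<Rightarrow> bit"
  shows "hadamard_equivalent (cochain_matrix (phi \<psi> f)) (cochain_matrix (\<psi> + delta1 f))"
proof -
  define S M where "S = {a. f a = 1}" and "M = cochain_matrix (phi \<psi> f)"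
  define M' where "M' = (\<chi> i j. if i \<in> S then - M $ i $ j else M $ i $ j)"
  have "hadamard_equivalent M M"
    unfolding M_def by (rule hadamard_equivalent.refl[OF pm1_matrix_cochain_matrix])
  then have "hadamard_equivalent M M'"
    unfolding M'_def by (rule hadamard_equivalent_negate_rows) simp
  then have "hadamard_equivalent M (\<chi> i j. if j \<in> S then - M' $ i $ j else M' $ i $ j)"
    by (rule hadamard_equivalent_negate_columns) simp
  \<comment> \<open>Here \<open>p\<close>, \<open>x\<close>, \<open>y\<close>, \<open>z\<close>
    stand for \<open>\<psi> a b\<close>, \<open>f a\<close>, \<open>f b\<close>,
    \<open>f (a * b)\<close>. The outer conditional is the column negation, the inner ones the row
    negation of the \<open>phi\<close> entry.\<close>
  moreover have "(- 1 :: int) ^ of_bit (p + (x + y + z))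
      = (if y = 1 then - (if x = 1 then - ((- 1) ^ of_bit (p + z)) else (- 1) ^ of_bit (p + z))
         else if x = 1 then - ((- 1) ^ of_bit (p + z)) else (- 1) ^ of_bit (p + z))" for p x y z :: bit
    by (cases p; cases x; cases y; cases z) simp_all
  then have "(\<chi> i j. if j \<in> S then - M' $ i $ j else M' $ i $ j) = cochain_matrix (\<psi> + delta1 f)"
    by (simp only: M'_def M_def S_def vec_eq_iff cochain_matrix_def phi_def delta1_def
        vec_lambda_beta plus_fun_apply mem_Collect_eq simp_thms)
  ultimately show ?thesis
    unfolding M_def by simp
qed

theorem lemma19:
  fixes \<psi> :: "'a::{finite,loop} \<Rightarrow> 'a \<Rightarrow> bit" and f :: "'a \<Rightarrow> bit"
  assumes "\<psi> \<in> two_loop_cocycles" and "delta2 \<psi> = delta_sq f"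
  shows "cocyclic (cochain_matrix (\<psi> + delta1 f))
    \<and> hadamard_equivalent (cochain_matrix (phi \<psi> f)) (cochain_matrix (\<psi> + delta1 f))
    \<and> (hadamard (cochain_matrix (phi \<psi> f)) \<longleftrightarrow> hadamard (cochain_matrix (\<psi> + delta1 f)))"
  \<comment> \<open>The cochain \<open>\<psi> + delta1 f\<close> itself is the witness for
    \<open>cocyclic\<close>.\<close>
  using two_cocycle_add_delta1[OF assms(2)] hadamard_equivalent_phi[of \<psi> f]
    hadamard_equivalent_imp_hadamard_iff[OF hadamard_equivalent_phi[of \<psi> f]]
  unfolding cocyclic_def by blast

end
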